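(* Consider the problem of minimizing $F=f+\psi$ and the inexact variable-metric block-coordinate descent algorithm (Algorithm A) described in the context. Assume that $f$ and $\psi$ are convex, that $f$ satisfies the blockwise Lipschitz condition with constants $L_1,\dots,L_N>0$, and that $F$ satisfies the optimal set strong convexity condition with parameter $\mu>0$: for any $x$ and any $\lambda\in[0,1]$, $$F(\lambda x+(1-\lambda)P_\Omega(x))\le\lambda F(x)+(1-\lambda)F^*-\tfrac12\mu\lambda(1-\lambda)\|x-P_\Omega(x)\|^2.$$ Suppose that at the $k$th iteration of Algorithm A, the $\eta$-approximate solution condition $\eta(Q^k_i(0)-Q^{k*}_i)\ge Q^k_i(d^k_i)-Q^{k*}_i$ is satisfied for some $\eta\in[0,1)$, and $H^k_i\succeq m_iI$ for some $m_i>0$, for all $i=1,\dots,N$ (so that the line-search step sizes $\alpha^k_i$ are all bounded away from $0$). Given any probability distribution $\{p^k_i\}_{i=1}^N>0$ for choosing the block, let $\pi^k:=\min_{1\le i\le N}\alpha^k_ip^k_i$. If $F(x^k)>F^*$, then $$\frac{\mathbb E_{i_k}[F(x^{k+1})-F^*\mid x^k]}{F(x^k)-F^*}\le1-(1-\eta)\gamma\rho_k,\qquad\text{where}\qquad \rho_k\ge\Big(\frac1{\pi^k}+\max_{1\le i\le N}\frac{\|H^k_i\|}{\mu\,\alpha^k_ip^k_i}\Big)^{-1}.$$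
   Context: Problem. Minimize $F(x)=f(x)+\psi(x)$ over $x\in\mathbb R^n$, where $x=(x_1,\dots,x_N)$ is split into $N$ blocks $x_i\in\mathbb R^{n_i}$, $\sum_i n_i=n$. $U_i\in\mathbb R^{n\times n_i}$ is the column submatrix of the identity with $x_i=U_i^\top x$; $\nabla_if:=U_i^\top\nabla f$. $f:\mathbb R^n\to\mathbb R$ is continuously differentiable and blockwise Lipschitz: $\|\nabla_if(x+U_ih)-\nabla_if(x)\|\le L_i\|h\|$ for all $x\in\mathbb R^n$, $h\in\mathbb R^{n_i}$, with $L_i>0$. $\psi(x)=\sum_i\psi_i(x_i)$ with each $\psi_i$ convex, extended-valued, proper and closed. $F$ is bounded below and its set of minimizers $\Omega$ is nonempty; $F^*$ is the minimum value; $P_\Omega$ is the Euclidean projection onto $\Omega$. $\|\cdot\|$ is the Euclidean norm for vectors and the spectral norm for matrices. In the optimal set strong convexity condition the convention $0\cdot\infty=0$ is used. Algorithm A. Given $\beta,\gamma\in(0,1)$, $\eta\in[0,1)$, $x^0$ with $F(x^0)<\infty$. At iteration $k=0,1,2,\dots$: pick a probability distribution $p^k_1,\dots,p^k_N>0$, $\sum_ip^k_i=1$, and sample $i_k$ from it. For a block $i$, with a symmetric positive-definite matrix $H^k_i\in\mathbb R^{n_i\times n_i}$, let $$Q^k_i(d_i):=\nabla_if(x^k)^\top d_i+\tfrac12d_i^\top H^k_id_i+\psi_i(x^k_i+d_i)-\psi_i(x^k_i),\qquad Q^{k*}_i:=\inf_{d_i}Q^k_i(d_i).$$ For $i=i_k$,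 compute an $\eta$-approximate minimizer $d^k_i$ of $Q^k_i$, i.e. $\eta(Q^k_i(0)-Q^{k*}_i)\ge Q^k_i(d^k_i)-Q^{k*}_i$. With $\Delta^k_i:=\nabla_if(x^k)^\top d^k_i+\psi_i(x^k_i+d^k_i)-\psi_i(x^k_i)$, let $\alpha^k_i$ be the largest value in $\{1,\beta,\beta^2,\dots\}$ with $F(x^k+\alpha^k_iU_id^k_i)\le F(x^k)+\alpha^k_i\gamma\Delta^k_i$. Set $x^{k+1}=x^k+\alpha^k_{i_k}U_{i_k}d^k_{i_k}$. Conventions. At each iteration, $H^k_i,d^k_i,\alpha^k_i$ are considered for every $i=1,\dots,N$ as the quantities that would result if $i$ were chosen as $i_k$. $\mathbb E_{i_k}[\cdot\mid x^k]$ is the expectation over $i_k$ (distributed according to $\{p^k_i\}$) with everything up to iteration $k$ fixed. "The inequality holds where $\rho_k\ge c$" means the inequality holds for some number $\rho_k\ge c$. *)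

theory Defs
  imports "HOL-Probability.Probability"
begin

text \<open>
  The block structure of \<open>real^'n\<close> is given by a map \<open>blk\<close> that assigns to each coordinate
  the index of its block. Since the block dimensions \<open>n\<^sub>i\<close> may differ, the space of the
  \<open>i\<close>-th block is represented by its isometric image under \<open>U\<^sub>i\<close>, the vectors vanishing outside
  block \<open>i\<close>. So \<open>block_part blk i x\<close> stands for \<open>x\<^sub>i\<close> (it is \<open>U\<^sub>i U\<^sub>i\<^sup>T x\<close>),
  \<open>block_part blk i (g x)\<close> with \<open>g\<close> the gradient of \<open>f\<close> stands for the block gradient, and an
  \<open>n\<^sub>i\<close> by \<open>n\<^sub>i\<close> matrix \<open>H\<close> is represented by \<open>U\<^sub>i H U\<^sub>i\<^sup>T\<close>, which has the same spectral norm.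
  A function \<open>\<psi>\<^sub>i\<close> is only ever evaluated on the space of block \<open>i\<close>.
\<close>

definition block_space :: "('n::finite \<Rightarrow> 'b) \<Rightarrow> 'b \<Rightarrow> (real^'n) set" where
  "block_space blk i = {h. \<forall>j. blk j \<noteq> i \<longrightarrow> h $ j = 0}"

definition block_part :: "('n::finite \<Rightarrow> 'b) \<Rightarrow> 'b \<Rightarrow> real^'n \<Rightarrow> real^'n" where
  "block_part blk i x = (\<chi> j. if blk j = i then x $ j else 0)"

definition sym_pos_def_on_block :: "('n::finite \<Rightarrow> 'b) \<Rightarrow> 'b \<Rightarrow> real^'n^'n \<Rightarrow> bool" where
  "sym_pos_def_on_block blk i H \<longleftrightarrow>
     (\<forall>r s. blk r \<noteq> i \<or> blk s \<noteq> i \<longrightarrow> H $ r $ s = 0) \<and>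
     transpose H = H \<and>
     (\<forall>h\<in>block_space blk i. h \<noteq> 0 \<longrightarrow> 0 < h \<bullet> (H *v h))"

definition spectral_norm :: "real^'n::finite^'n \<Rightarrow> real" where
  "spectral_norm H = onorm ((*v) H)"

definition proper_on :: "'a set \<Rightarrow> ('a \<Rightarrow> ereal) \<Rightarrow> bool" where
  "proper_on S \<phi> \<longleftrightarrow> (\<forall>x\<in>S. \<phi> x \<noteq> -\<infinity>) \<and> (\<exists>x\<in>S. \<phi> x \<noteq> \<infinity>)"

text \<open>Products with \<open>\<infinity>\<close> below use the library convention \<open>0 * \<infinity> = 0\<close> on \<open>ereal\<close>.\<close>

definition ereal_convex_on :: "'a::real_vector set \<Rightarrow> ('a \<Rightarrow> ereal) \<Rightarrow> bool" where
  "ereal_convex_on S \<phi> \<longleftrightarrow> (\<forall>x\<in>S. \<forall>y\<in>S. \<forall>t\<in>{0..1}.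
     \<phi> ((1 - t) *\<^sub>R x + t *\<^sub>R y) \<le> ereal (1 - t) * \<phi> x + ereal t * \<phi> y)"

definition closed_fun_on :: "'a::topological_space set \<Rightarrow> ('a \<Rightarrow> ereal) \<Rightarrow> bool" where
  "closed_fun_on S \<phi> \<longleftrightarrow> closed {(x, r :: real). x \<in> S \<and> \<phi> x \<le> ereal r}"

definition blockwise_lipschitz ::
  "('n::finite \<Rightarrow> 'b) \<Rightarrow> (real^'n \<Rightarrow> real^'n) \<Rightarrow> ('b \<Rightarrow> real) \<Rightarrow> bool" where
  "blockwise_lipschitz blk g L \<longleftrightarrow> (\<forall>i x. \<forall>h\<in>block_space blk i.
     norm (block_part blk i (g (x + h)) - block_part blk i (g x)) \<le> L i * norm h)"

definition objective ::
  "('n::finite \<Rightarrow> 'b::finite) \<Rightarrow> (real^'n \<Rightarrow> real) \<Rightarrow> ('b \<Rightarrow> real^'n \<Rightarrow> ereal) \<Rightarrow> real^'n \<Rightarrow> ereal" where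
  "objective blk f \<psi> x = ereal (f x) + (\<Sum>i\<in>UNIV. \<psi> i (block_part blk i x))"

definition minimizers :: "('a \<Rightarrow> ereal) \<Rightarrow> 'a set" where
  "minimizers F = {x. \<forall>y. F x \<le> F y}"

definition min_value :: "('a \<Rightarrow> ereal) \<Rightarrow> ereal" where
  "min_value F = (INF x. F x)"

definition optimal_set_strongly_convex :: "real \<Rightarrow> (real^'n::finite \<Rightarrow> ereal) \<Rightarrow> bool" where
  "optimal_set_strongly_convex \<mu> F \<longleftrightarrow> (\<forall>x. \<forall>l\<in>{0..1}.
     (let P = closest_point (minimizers F) x in
      F (l *\<^sub>R x + (1 - l) *\<^sub>R P)
        \<le> ereal l * F x + ereal (1 - l) * min_value F
          - ereal (1/2 * \<mu> * l * (1 - l) * (norm (x - P))\<^sup>2)))"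

text \<open>
  In the definitions of the algorithm, \<open>g\<close> is the gradient of \<open>f\<close>, and \<open>x\<close> is a point at which the
  objective is finite, so that the subtractions of \<open>\<psi>\<^sub>i(x\<^sub>i)\<close> subtract a finite value.
\<close>

definition subproblem ::
  "('n::finite \<Rightarrow> 'b) \<Rightarrow> (real^'n \<Rightarrow> real^'n) \<Rightarrow> ('b \<Rightarrow> real^'n \<Rightarrow> ereal) \<Rightarrow>
   real^'n \<Rightarrow> 'b \<Rightarrow> real^'n^'n \<Rightarrow> real^'n \<Rightarrow> ereal" where
  "subproblem blk g \<psi> x i H d =
     ereal (block_part blk i (g x) \<bullet> d + 1/2 * (d \<bullet> (H *v d)))
       + \<psi> i (block_part blk i x + d) - \<psi> i (block_part blk i x)"

definition approx_solution ::
  "('n::finite \<Rightarrow> 'b) \<Rightarrow> (real^'n \<Rightarrow> real^'n) \<Rightarrow> ('b \<Rightarrow> real^'n \<Rightarrow> ereal) \<Rightarrow>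
   real \<Rightarrow> real^'n \<Rightarrow> 'b \<Rightarrow> real^'n^'n \<Rightarrow> real^'n \<Rightarrow> bool" where
  "approx_solution blk g \<psi> \<eta> x i H d \<longleftrightarrow>
     d \<in> block_space blk i \<and>
     (let Q = subproblem blk g \<psi> x i H; Qmin = (INF e\<in>block_space blk i. Q e)
      in Q d - Qmin \<le> ereal \<eta> * (Q 0 - Qmin))"

definition model_decrease ::
  "('n::finite \<Rightarrow> 'b) \<Rightarrow> (real^'n \<Rightarrow> real^'n) \<Rightarrow> ('b \<Rightarrow> real^'n \<Rightarrow> ereal) \<Rightarrow>
   real^'n \<Rightarrow> 'b \<Rightarrow> real^'n \<Rightarrow> ereal" where
  "model_decrease blk g \<psi> x i d =
     ereal (block_part blk i (g x) \<bullet> d)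
       + \<psi> i (block_part blk i x + d) - \<psi> i (block_part blk i x)"

definition step_size ::
  "('n::finite \<Rightarrow> 'b::finite) \<Rightarrow> (real^'n \<Rightarrow> real) \<Rightarrow> (real^'n \<Rightarrow> real^'n) \<Rightarrow>
   ('b \<Rightarrow> real^'n \<Rightarrow> ereal) \<Rightarrow> real \<Rightarrow> real \<Rightarrow> real^'n \<Rightarrow> 'b \<Rightarrow> real^'n \<Rightarrow> real" where
  "step_size blk f g \<psi> \<beta> \<gamma> x i d =
     (GREATEST a. a \<in> range (\<lambda>t::nat. \<beta> ^ t) \<and>
        objective blk f \<psi> (x + a *\<^sub>R d)
          \<le> objective blk f \<psi> x + ereal (a * \<gamma>) * model_decrease blk g \<psi> x i d)"

text \<open>
  \<open>iterate blk f g \<psi> \<beta> \<gamma> \<eta> k x\<close>: the point \<open>x\<close> can occur as the \<open>k\<close>-th iterate. All sampling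
  probabilities are positive, so any block may be drawn in any iteration.
\<close>

inductive iterate ::
  "('n::finite \<Rightarrow> 'b::finite) \<Rightarrow> (real^'n \<Rightarrow> real) \<Rightarrow> (real^'n \<Rightarrow> real^'n) \<Rightarrow>
   ('b \<Rightarrow> real^'n \<Rightarrow> ereal) \<Rightarrow> real \<Rightarrow> real \<Rightarrow> real \<Rightarrow> nat \<Rightarrow> real^'n \<Rightarrow> bool"
  for blk f g \<psi> \<beta> \<gamma> \<eta> where
  start: "objective blk f \<psi> x < \<infinity> \<Longrightarrow> iterate blk f g \<psi> \<beta> \<gamma> \<eta> 0 x"
| step: "iterate blk f g \<psi> \<beta> \<gamma> \<eta> k x \<Longrightarrow>
    sym_pos_def_on_block blk i H \<Longrightarrow> approx_solution blk g \<psi> \<eta> x i H d \<Longrightarrow>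
    iterate blk f g \<psi> \<beta> \<gamma> \<eta> (Suc k) (x + step_size blk f g \<psi> \<beta> \<gamma> x i d *\<^sub>R d)"

text \<open>Expectation of an extended-valued random variable over a finite sample space; a value
  \<open>\<infinity>\<close> at some block of positive probability makes it infinite.\<close>

definition expected :: "'b::finite pmf \<Rightarrow> ('b \<Rightarrow> ereal) \<Rightarrow> ereal" where
  "expected p X = (\<Sum>i\<in>UNIV. ereal (pmf p i) * X i)"

end

theory Submission
  imports Defs
begin

text \<open>
  Fix an iterate \<open>x\<close>, write \<open>q\<^sub>i\<close> for the infimum of the block model \<open>Q\<^sub>i\<close> and \<open>\<delta>\<^sub>i\<close> for the
  linearized decrease \<open>\<Delta>\<^sub>i\<close> of the computed step.

  Step sizes. The accuracy condition and coercivity of \<open>H\<^sub>i\<close> give \<open>\<delta>\<^sub>i \<le> - (m\<^sub>i / 2) \<parallel>d\<^sub>i\<parallel>\<^sup>2\<close>,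
  whereas the error of linearizing \<open>f\<close> along \<open>t d\<^sub>i\<close> is at most \<open>(L\<^sub>i / 2) t\<^sup>2 \<parallel>d\<^sub>i\<parallel>\<^sup>2\<close>. So every
  \<open>t \<le> 1\<close> with \<open>t \<le> (1 - \<gamma>) m\<^sub>i / L\<^sub>i\<close> passes the line search
  (\<open>sufficient_decrease\<close>), and a power of \<open>\<beta>\<close> below all these thresholds bounds every step
  size from below. This presupposes that \<open>q\<^sub>i\<close> is finite, since for \<open>q\<^sub>i = - \<infinity>\<close> the accuracy
  condition says nothing when \<open>\<eta> > 0\<close>; finiteness comes from a linear lower bound on \<open>\<psi>\<^sub>i\<close>
  (\<open>part_linear_lower_bound\<close>).
  Finiteness of the objective at every iterate needs a coercivity constant for whichever matrix was
  used earlier, which positive definiteness supplies by compactness.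

  Expected decrease. The line search and the accuracy condition give
  \<open>E[F(x + \<alpha>\<^sub>i d\<^sub>i)] - F(x) \<le> \<gamma> \<Sum>\<^sub>i p\<^sub>i \<alpha>\<^sub>i \<delta>\<^sub>i \<le> (1 - \<eta>) \<gamma> \<Sum>\<^sub>i p\<^sub>i \<alpha>\<^sub>i q\<^sub>i\<close>, so it remains to show that
  the last sum is at most \<open>- \<rho> (F(x) - F\<^sup>*)\<close> (\<open>weighted_subproblem_decrease\<close>). Put
  \<open>s = P\<^sub>\<Omega>(x) - x\<close>, \<open>w\<^sub>i = \<alpha>\<^sub>i p\<^sub>i\<close> and \<open>\<pi> = min\<^sub>i w\<^sub>i\<close>, and bound \<open>q\<^sub>i\<close> by the value of \<open>Q\<^sub>i\<close> at
  \<open>(\<rho> / w\<^sub>i) s\<^sub>i = (\<pi> / w\<^sub>i) \<theta> s\<^sub>i\<close> with \<open>\<theta> = \<rho> / \<pi>\<close>. Since \<open>\<pi> / w\<^sub>i \<le> 1\<close>, convexity of \<open>\<psi>\<^sub>i\<close> and \<open>f\<close>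
  bounds the weighted sum by
  \<open>\<pi> (F(x + \<theta> s) - F(x)) + (\<rho>\<^sup>2 / 2) \<Sum>\<^sub>i (\<parallel>H\<^sub>i\<parallel> / w\<^sub>i) \<parallel>s\<^sub>i\<parallel>\<^sup>2\<close>. Optimal set strong convexity bounds
  the first term by \<open>- \<rho> (F(x) - F\<^sup>*) - (\<mu> / 2) \<rho> (1 - \<theta>) \<parallel>s\<parallel>\<^sup>2\<close>. The quadratic terms
  add up to at most \<open>0\<close> as soon as \<open>\<rho> max\<^sub>i \<parallel>H\<^sub>i\<parallel> / (\<mu> w\<^sub>i) \<le> 1 - \<theta>\<close>, and \<open>\<rho>\<close> is the value for
  which this holds with equality.
\<close>

section \<open>Blocks of coordinates\<close>

lemma block_part_in_block_space [simp]: "block_part blk i x \<in> block_space blk i"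
  by (simp add: block_part_def block_space_def)

lemma block_space_subspace:
  shows zero_in_block_space [simp]: "0 \<in> block_space blk i"
    and add_in_block_space: "u \<in> block_space blk i \<Longrightarrow> v \<in> block_space blk i \<Longrightarrow> u + v \<in> block_space blk i"
    and scale_in_block_space: "u \<in> block_space blk i \<Longrightarrow> a *\<^sub>R u \<in> block_space blk i"
  by (simp_all add: block_space_def)

lemma block_part_add: "block_part blk i (x + y) = block_part blk i x + block_part blk i y"
  and block_part_scale: "block_part blk i (a *\<^sub>R x) = a *\<^sub>R block_part blk i x"
  by (simp_all add: block_part_def vec_eq_iff)

lemma block_part_of_block:
  assumes "h \<in> block_space blk i"
  shows "block_part blk j h = (if j = i then h else 0)"
  using assms by (auto simp: block_part_def block_space_def vec_eq_iff)

lemma inner_block_part: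
  assumes "h \<in> block_space blk i"
  shows "block_part blk i y \<bullet> h = y \<bullet> h"
  using assms by (auto simp: block_part_def block_space_def inner_vec_def intro!: sum.cong)

lemma sum_inner_block_part:
  fixes blk :: "'n::finite \<Rightarrow> 'b::finite"
  shows "(\<Sum>i\<in>UNIV. block_part blk i x \<bullet> block_part blk i y) = x \<bullet> y"
proof -
  have "(\<Sum>i\<in>UNIV. block_part blk i x \<bullet> block_part blk i y)
      = (\<Sum>i\<in>UNIV. \<Sum>j\<in>UNIV. if i = blk j then x $ j * y $ j else 0)"
    by (auto simp: block_part_def inner_vec_def intro!: sum.cong)
  also have "\<dots> = (\<Sum>j\<in>UNIV. \<Sum>i\<in>UNIV. if i = blk j then x $ j * y $ j else 0)"
    by (rule sum.swap)
  also have "\<dots> = x \<bullet> y"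
    by (simp add: inner_vec_def)
  finally show ?thesis .
qed

lemma spectral_norm_nonneg: "0 \<le> spectral_norm H"
  unfolding spectral_norm_def by (rule onorm_pos_le) (rule matrix_vector_mul_bounded_linear)

lemma quadratic_form_le_spectral_norm: "h \<bullet> (H *v h) \<le> spectral_norm H * (h \<bullet> h)"
proof -
  have "h \<bullet> (H *v h) \<le> norm h * norm (H *v h)"
    by (rule norm_cauchy_schwarz)
  also have "\<dots> \<le> norm h * (spectral_norm H * norm h)"
    unfolding spectral_norm_def
    by (intro mult_left_mono onorm matrix_vector_mul_bounded_linear) auto
  also have "\<dots> = spectral_norm H * (h \<bullet> h)"
    unfolding dot_square_norm power2_eq_square by (simp only: mult_ac)
  finally show ?thesis .
qed

text \<open>On the compact unit sphere of the block space the quadratic form attains a positive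
  minimum.\<close>

lemma pos_def_on_block_imp_coercive:
  fixes blk :: "'n::finite \<Rightarrow> 'b"
  assumes "sym_pos_def_on_block blk i H"
  obtains m where "0 < m" "\<And>h. h \<in> block_space blk i \<Longrightarrow> m * (h \<bullet> h) \<le> h \<bullet> (H *v h)"
proof -
  define S where "S = block_space blk i \<inter> sphere 0 1"
  have pos: "0 < h \<bullet> (H *v h)" if "h \<in> block_space blk i" "h \<noteq> 0" for h
    using assms that by (auto simp: sym_pos_def_on_block_def)
  have unit: "h /\<^sub>R norm h \<in> S" if "h \<in> block_space blk i" "h \<noteq> 0" for h
    using that by (simp add: S_def scale_in_block_space)
  show thesis
  proof (cases "S = {}")
    case True
    with unit have zero: "h = 0" if "h \<in> block_space blk i" for h
      using that by blast
    show thesis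
      by (rule that[of 1]) (auto dest: zero)
  next
    case False
    have "closed (\<Inter>j\<in>{j. blk j \<noteq> i}. {h::real^'n. h $ j = 0})"
      by (intro closed_INT ballI closed_Collect_eq continuous_intros)
    then have "closed (block_space blk i)"
      by (simp add: block_space_def Inter_eq)
    then have "compact S"
      unfolding S_def by (intro closed_Int_compact) auto
    moreover have "continuous_on S (\<lambda>h. h \<bullet> (H *v h))"
      by (intro continuous_intros)
    ultimately obtain e where e: "e \<in> S" "\<And>h. h \<in> S \<Longrightarrow> e \<bullet> (H *v e) \<le> h \<bullet> (H *v h)"
      using continuous_attains_inf[of S "\<lambda>h. h \<bullet> (H *v h)"] False by blast
    show thesis
    proof
      show "0 < e \<bullet> (H *v e)"
        using e(1) by (intro pos) (auto simp: S_def)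
      fix h assume h: "h \<in> block_space blk i"
      show "e \<bullet> (H *v e) * (h \<bullet> h) \<le> h \<bullet> (H *v h)"
      proof (cases "h = 0")
        case False
        have "e \<bullet> (H *v e) \<le> (h /\<^sub>R norm h) \<bullet> (H *v (h /\<^sub>R norm h))"
          using e(2) unit[OF h False] by blast
        also have "\<dots> = (h \<bullet> (H *v h)) / (h \<bullet> h)"
          by (simp add: matrix_vector_mult_scaleR dot_square_norm power2_eq_square divide_simps)
        finally show ?thesis
          using False by (simp add: pos_le_divide_eq)
      qed (simp add: matrix_vector_mult_0_right)
    qed
  qed
qed

section \<open>Smooth functions along a line\<close>

lemma has_real_derivative_along_line:
  assumes "GDERIV f (x + t *\<^sub>R h) :> g"
  shows "((\<lambda>t. f (x + t *\<^sub>R h)) has_real_derivative h \<bullet> g) (at t)"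
proof -
  have "((\<lambda>t. x + t *\<^sub>R h) has_derivative (\<lambda>s. s *\<^sub>R h)) (at t)"
    by (auto intro!: derivative_eq_intros)
  from has_derivative_compose[OF this assms[unfolded gderiv_def]]
  show ?thesis
    by (simp add: has_field_derivative_def mult.commute[of _ "h \<bullet> g"])
qed

lemma convex_above_gradient:
  assumes conv: "convex_on UNIV f" and gder: "GDERIV f x :> g"
  shows "f x + g \<bullet> h \<le> f (x + h)"
proof -
  have "convex_on UNIV (\<lambda>t::real. f (x + t *\<^sub>R h))"
  proof (rule convex_onI)
    fix t u v :: real assume t: "0 < t" "t < 1"
    have "x + ((1 - t) *\<^sub>R u + t *\<^sub>R v) *\<^sub>R h
        = (1 - t) *\<^sub>R (x + u *\<^sub>R h) + t *\<^sub>R (x + v *\<^sub>R h)"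
      by (simp add: algebra_simps)
    then show "f (x + ((1 - t) *\<^sub>R u + t *\<^sub>R v) *\<^sub>R h)
        \<le> (1 - t) * f (x + u *\<^sub>R h) + t * f (x + v *\<^sub>R h)"
      using convex_onD[OF conv, of t "x + u *\<^sub>R h" "x + v *\<^sub>R h"] t by simp
  qed auto
  moreover have "((\<lambda>t. f (x + t *\<^sub>R h)) has_real_derivative h \<bullet> g) (at 0 within UNIV)"
    using has_real_derivative_along_line[of f x 0 h g] gder by simp
  ultimately have "(h \<bullet> g) * (1 - 0) \<le> f (x + 1 *\<^sub>R h) - f (x + 0 *\<^sub>R h)"
    by (intro convex_on_imp_above_tangent[of UNIV]) auto
  then show ?thesis
    by (simp add: inner_commute)
qed

section \<open>The block-separable composite problem\<close>

locale block_composite =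
  fixes blk :: "'n::finite \<Rightarrow> 'b::finite"
    and f :: "real^'n \<Rightarrow> real" and g :: "real^'n \<Rightarrow> real^'n"
    and \<psi> :: "'b \<Rightarrow> real^'n \<Rightarrow> ereal" and L :: "'b \<Rightarrow> real" and b :: real
  assumes gradient: "\<And>x. GDERIV f x :> g x"
    and L_pos: "\<And>i. 0 < L i"
    and lipschitz: "blockwise_lipschitz blk g L"
    and convex_part: "\<And>i. ereal_convex_on (block_space blk i) (\<psi> i)"
    and proper_part: "\<And>i. proper_on (block_space blk i) (\<psi> i)"
    and bounded_below: "\<And>x. ereal b \<le> objective blk f \<psi> x"
begin

abbreviation F :: "real^'n \<Rightarrow> ereal" where
  "F \<equiv> objective blk f \<psi>"

text \<open>Integrating the Lipschitz bound on the block gradient along the segment: the difference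
  between \<open>f\<close> and its quadratic upper model has a nonpositive derivative.\<close>

lemma block_descent:
  assumes h: "h \<in> block_space blk i"
  shows "f (x + h) \<le> f x + g x \<bullet> h + L i / 2 * (h \<bullet> h)"
proof -
  define \<phi> where "\<phi> t = f (x + t *\<^sub>R h) - t * (g x \<bullet> h) - L i / 2 * t\<^sup>2 * (h \<bullet> h)" for t :: real
  have "\<phi> 1 \<le> \<phi> 0"
  proof (rule DERIV_nonpos_imp_nonincreasing[of 0 1 \<phi>])
    fix t :: real assume t: "0 \<le> t" "t \<le> 1"
    have "(\<phi> has_real_derivative
            h \<bullet> g (x + t *\<^sub>R h) - g x \<bullet> h - L i * t * (h \<bullet> h)) (at t)"
      unfolding \<phi>_def
      by (auto intro!: derivative_eq_intros has_real_derivative_along_line gradient)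
    moreover have "h \<bullet> g (x + t *\<^sub>R h) - g x \<bullet> h \<le> L i * t * (h \<bullet> h)"
    proof -
      have "h \<bullet> g (x + t *\<^sub>R h) - g x \<bullet> h
          = (block_part blk i (g (x + t *\<^sub>R h)) - block_part blk i (g x)) \<bullet> h"
        using h by (simp add: inner_diff_left inner_block_part inner_commute[of h])
      also have "\<dots> \<le> norm (block_part blk i (g (x + t *\<^sub>R h)) - block_part blk i (g x)) * norm h"
        by (rule norm_cauchy_schwarz)
      also have "\<dots> \<le> L i * norm (t *\<^sub>R h) * norm h"
        using lipschitz scale_in_block_space[OF h, of t]
        unfolding blockwise_lipschitz_def by (intro mult_right_mono norm_ge_zero) blast
      also have "\<dots> = L i * t * (h \<bullet> h)"
        unfolding dot_square_norm power2_eq_square using t by simp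
      finally show ?thesis .
    qed
    ultimately show "\<exists>y. (\<phi> has_real_derivative y) (at t) \<and> y \<le> 0"
      by force
  qed simp
  then show ?thesis
    by (simp add: \<phi>_def)
qed

lemma part_not_minus_infinity: "u \<in> block_space blk i \<Longrightarrow> \<psi> i u \<noteq> -\<infinity>"
  using proper_part[of i] by (auto simp: proper_on_def)

lemma objective_finite_imp_part_finite:
  assumes "F x < \<infinity>"
  obtains a where "\<And>i. \<psi> i (block_part blk i x) = ereal (a i)"
    and "F x = ereal (f x + (\<Sum>i\<in>UNIV. a i))"
proof -
  have "(\<Sum>i\<in>UNIV. \<psi> i (block_part blk i x)) \<noteq> \<infinity>"
    using assms by (auto simp: objective_def)
  then have "\<psi> i (block_part blk i x) \<noteq> \<infinity>" for i
    by (auto simp: sum_Pinfty)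
  then have *: "\<psi> i (block_part blk i x) = ereal (real_of_ereal (\<psi> i (block_part blk i x)))" for i
    using part_not_minus_infinity[of "block_part blk i x" i]
    by (cases "\<psi> i (block_part blk i x)") auto
  have "F x = ereal (f x + (\<Sum>i\<in>UNIV. real_of_ereal (\<psi> i (block_part blk i x))))"
    unfolding objective_def by (subst *) (simp only: sum_ereal plus_ereal.simps)
  with * show thesis by (rule that)
qed

lemma part_finite:
  assumes "F x < \<infinity>"
  obtains a where "\<psi> i (block_part blk i x) = ereal a"
  using objective_finite_imp_part_finite[OF assms] by metis

lemma objective_block_step:
  assumes x: "F x = ereal Fx" and a: "\<psi> i (block_part blk i x) = ereal a"
    and h: "h \<in> block_space blk i" and c: "\<psi> i (block_part blk i x + h) = ereal c"
  shows "F (x + h) = ereal (Fx + (f (x + h) - f x) + (c - a))"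
proof -
  obtain A where A: "\<And>i. \<psi> i (block_part blk i x) = ereal (A i)"
    and Fx: "F x = ereal (f x + (\<Sum>i\<in>UNIV. A i))"
    using objective_finite_imp_part_finite[of x] x by auto
  have part: "\<psi> j (block_part blk j (x + h)) = ereal ((A(i := c)) j)" for j
    using h A c by (simp add: block_part_add block_part_of_block)
  have "(\<Sum>j\<in>UNIV. (A(i := c)) j) = (\<Sum>j\<in>UNIV. A j + (if j = i then c - A i else 0))"
    by (intro sum.cong) auto
  also have "\<dots> = (\<Sum>j\<in>UNIV. A j) + (c - A i)"
    by (simp add: sum.distrib)
  finally show ?thesis
    using x Fx A[of i] a unfolding objective_def part sum_ereal by simp
qed

lemma part_convex_along_segment:
  assumes "u \<in> block_space blk i" "v \<in> block_space blk i"
    and "\<psi> i u = ereal a" "\<psi> i (u + v) = ereal c" and t: "0 \<le> t" "t \<le> 1"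
  obtains e where "\<psi> i (u + t *\<^sub>R v) = ereal e" "e \<le> a + t * (c - a)"
proof -
  have "(1 - t) *\<^sub>R u + t *\<^sub>R (u + v) = u + t *\<^sub>R v"
    by (simp add: algebra_simps)
  with assms convex_part[of i] have "\<psi> i (u + t *\<^sub>R v) \<le> ereal (1 - t) * ereal a + ereal t * ereal c"
    unfolding ereal_convex_on_def
    by (metis add_in_block_space atLeastAtMost_iff)
  then have le: "\<psi> i (u + t *\<^sub>R v) \<le> ereal (a + t * (c - a))"
    by (simp add: algebra_simps)
  moreover have "\<psi> i (u + t *\<^sub>R v) \<noteq> -\<infinity>"
    using assms by (intro part_not_minus_infinity add_in_block_space scale_in_block_space)
  ultimately obtain e where "\<psi> i (u + t *\<^sub>R v) = ereal e"
    by (cases "\<psi> i (u + t *\<^sub>R v)") auto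
  with le show thesis
    by (intro that) auto
qed

section \<open>Approximate solutions of the block subproblems\<close>

text \<open>Since \<open>F\<close> is bounded below and \<open>f\<close> is bounded on the unit ball around \<open>x\<close>, the function
  \<open>\<psi>\<^sub>i\<close> is bounded below there; convexity along the ray through a point outside that ball
  turns this into a lower bound that is linear in the norm.\<close>

lemma part_linear_lower_bound:
  assumes fin: "F x < \<infinity>" and a: "\<psi> i (block_part blk i x) = ereal a"
  obtains K where "0 \<le> K"
    "\<And>e c. e \<in> block_space blk i \<Longrightarrow> \<psi> i (block_part blk i x + e) = ereal c
        \<Longrightarrow> - K * (1 + norm e) \<le> c - a"
proof -
  obtain Fx where Fx: "F x = ereal Fx"
    using objective_finite_imp_part_finite[OF fin] by metis
  have "f differentiable (at y)" for y
    using gradient[of y] by (auto simp: gderiv_def differentiable_def)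
  then have "continuous_on (cball x 1) f"
    by (auto intro!: continuous_at_imp_continuous_on differentiable_imp_continuous_within)
  then have "bounded (f ` cball x 1)"
    by (intro compact_imp_bounded compact_continuous_image) auto
  then obtain M where M: "\<And>y. y \<in> cball x 1 \<Longrightarrow> \<bar>f y\<bar> \<le> M"
    unfolding bounded_iff by (metis image_eqI real_norm_def)
  define K where "K = \<bar>b - Fx - M + f x\<bar>"
  have ball: "- K \<le> c - a"
    if "e \<in> block_space blk i" "\<psi> i (block_part blk i x + e) = ereal c" "norm e \<le> 1" for e c
  proof -
    have "b \<le> Fx + (f (x + e) - f x) + (c - a)"
      using bounded_below[of "x + e"] objective_block_step[OF Fx a that(1,2)] by simp
    moreover have "f (x + e) \<le> M"
      using M[of "x + e"] that(3) by (auto simp: dist_norm)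
    ultimately show ?thesis
      unfolding K_def by linarith
  qed
  (* Outside the ball, convexity at the point where the ray meets the unit sphere scales
     the bound by the norm of e. *)
  show thesis
  proof
    show "0 \<le> K" by (simp add: K_def)
    fix e c assume e: "e \<in> block_space blk i" and c: "\<psi> i (block_part blk i x + e) = ereal c"
    show "- K * (1 + norm e) \<le> c - a"
    proof (cases "norm e \<le> 1")
      case True
      have "- K * (1 + norm e) \<le> - K"
        using \<open>0 \<le> K\<close> by (simp add: algebra_simps)
      with ball[OF e c True] show ?thesis by linarith
    next
      case False
      obtain c' where c': "\<psi> i (block_part blk i x + (1 / norm e) *\<^sub>R e) = ereal c'"
        "c' \<le> a + (1 / norm e) * (c - a)"
        using part_convex_along_segment[OF _ e a c, of "1 / norm e"] False
        by (auto simp: divide_le_eq_1)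
      have "- K \<le> c' - a"
        using False e by (intro ball[OF _ c'(1)]) (auto simp: scale_in_block_space)
      also have "\<dots> \<le> (c - a) / norm e"
        using c'(2) by simp
      finally have "- K \<le> (c - a) / norm e" .
      moreover have "0 < norm e"
        using False by linarith
      ultimately have "- K * norm e \<le> c - a"
        by (simp only: pos_le_divide_eq)
      with \<open>0 \<le> K\<close> show ?thesis
        by (simp add: algebra_simps)
    qed
  qed
qed

text \<open>A strongly convex quadratic dominates the linear decrease that \<open>\<psi>\<^sub>i\<close> and the gradient term
  allow. A finite infimum is what gives the relative accuracy condition its content.\<close>

lemma subproblem_bounded_below:
  assumes fin: "F x < \<infinity>" and m: "0 < m"
    and coercive: "\<And>h. h \<in> block_space blk i \<Longrightarrow> m * (h \<bullet> h) \<le> h \<bullet> (H *v h)"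
  obtains B where "\<And>e. e \<in> block_space blk i \<Longrightarrow> ereal B \<le> subproblem blk g \<psi> x i H e"
proof -
  obtain a where a: "\<psi> i (block_part blk i x) = ereal a"
    using part_finite[OF fin] .
  obtain K where K: "0 \<le> K"
    "\<And>e c. e \<in> block_space blk i \<Longrightarrow> \<psi> i (block_part blk i x + e) = ereal c
        \<Longrightarrow> - K * (1 + norm e) \<le> c - a"
    using part_linear_lower_bound[OF fin a] by blast
  define G where "G = norm (g x) + K"
  show thesis
  proof
    fix e assume e: "e \<in> block_space blk i"
    let ?u = "block_part blk i x + e"
    have "\<psi> i ?u \<noteq> -\<infinity>"
      using e by (intro part_not_minus_infinity add_in_block_space) auto
    then consider "\<psi> i ?u = \<infinity>" | c where "\<psi> i ?u = ereal c"
      by (cases "\<psi> i ?u") auto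
    then show "ereal (- K - G\<^sup>2 / (2 * m)) \<le> subproblem blk g \<psi> x i H e"
    proof cases
      case 1
      then show ?thesis by (simp add: subproblem_def a)
    next
      case 2
      have "- (norm (g x) * norm e) \<le> g x \<bullet> e"
        using Cauchy_Schwarz_ineq2[of "g x" e] by linarith
      moreover have "m * (norm e)\<^sup>2 \<le> e \<bullet> (H *v e)"
        using coercive[OF e] by (simp add: dot_square_norm)
      moreover have "- K * (1 + norm e) \<le> c - a"
        using K(2)[OF e 2] .
      moreover have "0 \<le> (m * norm e - G)\<^sup>2 / (2 * m)"
        using m by simp
      then have "G * norm e \<le> m * (norm e)\<^sup>2 / 2 + G\<^sup>2 / (2 * m)"
        using m by (simp add: field_simps power2_eq_square)
      ultimately have "- K - G\<^sup>2 / (2 * m) \<le> g x \<bullet> e + 1/2 * (e \<bullet> (H *v e)) + c - a"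
        by (simp add: G_def algebra_simps)
      then show ?thesis
        using e by (simp add: subproblem_def a 2 inner_block_part)
    qed
  qed
qed

lemma approx_solution_decrease:
  assumes fin: "F x < \<infinity>" and m: "0 < m"
    and coercive: "\<And>h. h \<in> block_space blk i \<Longrightarrow> m * (h \<bullet> h) \<le> h \<bullet> (H *v h)"
    and \<eta>: "0 \<le> \<eta>" "\<eta> < 1" and approx: "approx_solution blk g \<psi> \<eta> x i H d"
  obtains \<delta> q c where "model_decrease blk g \<psi> x i d = ereal \<delta>"
    and "\<psi> i (block_part blk i x + d) = ereal c"
    and "\<And>e. e \<in> block_space blk i \<Longrightarrow> ereal q \<le> subproblem blk g \<psi> x i H e"
    and "\<delta> \<le> (1 - \<eta>) * q" and "\<delta> \<le> - (m / 2) * (d \<bullet> d)"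
proof -
  let ?Q = "subproblem blk g \<psi> x i H"
  let ?q = "INF e\<in>block_space blk i. ?Q e"
  obtain B where B: "\<And>e. e \<in> block_space blk i \<Longrightarrow> ereal B \<le> ?Q e"
    using subproblem_bounded_below[OF fin m coercive] by blast
  obtain a where a: "\<psi> i (block_part blk i x) = ereal a"
    using part_finite[OF fin] .
  have d: "d \<in> block_space blk i" and acc: "?Q d - ?q \<le> ereal \<eta> * (?Q 0 - ?q)"
    using approx by (auto simp: approx_solution_def Let_def)
  have Q0: "?Q 0 = 0"
    by (simp add: subproblem_def a)
  have "ereal B \<le> ?q"
    using B by (rule INF_greatest)
  moreover have "?q \<le> 0"
    using INF_lower[of 0 "block_space blk i" ?Q] Q0 by simp
  ultimately obtain q where q: "?q = ereal q" "q \<le> 0"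
    by (cases ?q) auto
  have le: "?Q d - ereal q \<le> ereal (- \<eta> * q)"
    using acc by (simp add: q Q0)
  have "\<psi> i (block_part blk i x + d) \<noteq> -\<infinity>"
    using d by (intro part_not_minus_infinity add_in_block_space) auto
  moreover have "\<psi> i (block_part blk i x + d) \<noteq> \<infinity>"
    using le by (auto simp: subproblem_def a)
  ultimately obtain c where c: "\<psi> i (block_part blk i x + d) = ereal c"
    by (cases "\<psi> i (block_part blk i x + d)") auto
  define \<delta> where "\<delta> = block_part blk i (g x) \<bullet> d + c - a"
  have *: "\<delta> + 1/2 * (d \<bullet> (H *v d)) \<le> (1 - \<eta>) * q"
  proof -
    have "\<delta> + 1/2 * (d \<bullet> (H *v d)) - q \<le> - \<eta> * q"
      using le by (simp add: subproblem_def a c \<delta>_def)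
    then show ?thesis
      by (simp add: left_diff_distrib)
  qed
  have "m * (d \<bullet> d) \<le> d \<bullet> (H *v d)" "(1 - \<eta>) * q \<le> 0" "0 \<le> m * (d \<bullet> d)"
    using coercive[OF d] \<eta> q(2) m by (auto simp: mult_nonneg_nonpos)
  with * have "\<delta> \<le> (1 - \<eta>) * q" "\<delta> \<le> - (m / 2) * (d \<bullet> d)"
    by linarith+
  moreover have "ereal q \<le> ?Q e" if "e \<in> block_space blk i" for e
    using INF_lower[OF that, of ?Q] q(1) by simp
  ultimately show thesis
    using c by (intro that[of \<delta> c q]) (auto simp: model_decrease_def a \<delta>_def)
qed

section \<open>Step sizes and iterates\<close>

text \<open>The second-order term of the block descent inequality is \<open>O(t\<^sup>2)\<close>, while the predicted
  decrease is of order \<open>t\<close> and itself controls the squared norm of \<open>d\<close>.\<close>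

lemma sufficient_decrease:
  assumes x: "F x = ereal Fx" and d: "d \<in> block_space blk i"
    and \<delta>: "model_decrease blk g \<psi> x i d = ereal \<delta>"
    and c: "\<psi> i (block_part blk i x + d) = ereal c"
    and m: "0 < m" "\<delta> \<le> - (m / 2) * (d \<bullet> d)"
    and t: "0 \<le> t" "t \<le> 1" "t \<le> (1 - \<gamma>) * m / L i"
  shows "F (x + t *\<^sub>R d) \<le> F x + ereal (t * \<gamma>) * ereal \<delta>"
proof -
  obtain a where a: "\<psi> i (block_part blk i x) = ereal a"
    using part_finite[of x] x by auto
  have \<delta>': "\<delta> = g x \<bullet> d + c - a"
    using \<delta> d by (simp add: model_decrease_def a c inner_block_part)
  obtain e where e: "\<psi> i (block_part blk i x + t *\<^sub>R d) = ereal e" "e \<le> a + t * (c - a)"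
    using part_convex_along_segment[OF _ d a c t(1,2)] by auto
  have td: "t *\<^sub>R d \<in> block_space blk i"
    using d by (rule scale_in_block_space)
  have "f (x + t *\<^sub>R d) - f x + (e - a) \<le> t * \<delta> + t * (t * L i) * (d \<bullet> d) / 2"
    using block_descent[OF td, of x] e(2) by (simp add: \<delta>' algebra_simps)
  also have "t * (t * L i) * (d \<bullet> d) \<le> t * ((1 - \<gamma>) * m) * (d \<bullet> d)"
    using t L_pos[of i] by (intro mult_right_mono mult_left_mono) (auto simp: pos_le_divide_eq)
  also have "t * ((1 - \<gamma>) * m) * (d \<bullet> d) = (t * (1 - \<gamma>)) * (m * (d \<bullet> d))"
    by simp
  also have "\<dots> \<le> (t * (1 - \<gamma>)) * (- 2 * \<delta>)"
  proof (rule mult_left_mono)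
    have "0 \<le> t * L i" "t * L i \<le> (1 - \<gamma>) * m"
      using t L_pos[of i] by (auto simp: pos_le_divide_eq)
    then have "0 \<le> (1 - \<gamma>) * m"
      by linarith
    then have "0 \<le> 1 - \<gamma>"
      using m by (simp add: zero_le_mult_iff)
    then show "0 \<le> t * (1 - \<gamma>)"
      using t by simp
  qed (use m in linarith)
  finally have "f (x + t *\<^sub>R d) - f x + (e - a) \<le> t * \<gamma> * \<delta>"
    by (simp add: field_simps)
  then show ?thesis
    unfolding objective_block_step[OF x a td e(1)] by (simp add: x)
qed

lemma step_size_bounds:
  assumes x: "F x = ereal Fx" and d: "d \<in> block_space blk i"
    and \<delta>: "model_decrease blk g \<psi> x i d = ereal \<delta>"
    and c: "\<psi> i (block_part blk i x + d) = ereal c"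
    and m: "0 < m" "\<delta> \<le> - (m / 2) * (d \<bullet> d)"
    and \<beta>: "0 < \<beta>" "\<beta> < 1"
    and T: "\<beta> ^ T \<le> (1 - \<gamma>) * m / L i"
  defines "\<alpha> \<equiv> step_size blk f g \<psi> \<beta> \<gamma> x i d"
  shows "\<beta> ^ T \<le> \<alpha>" and "F (x + \<alpha> *\<^sub>R d) \<le> F x + ereal (\<alpha> * \<gamma>) * ereal \<delta>"
proof -
  define P where "P = (\<lambda>t. F (x + \<beta> ^ t *\<^sub>R d) \<le> F x + ereal (\<beta> ^ t * \<gamma>) * ereal \<delta>)"
  have PT: "P T"
    unfolding P_def using \<beta> T
    by (intro sufficient_decrease[OF x d \<delta> c m]) (auto intro: power_le_one)
  define s where "s = (LEAST t. P t)"
  have Ps: "P s" and least: "\<And>t. P t \<Longrightarrow> s \<le> t"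
    unfolding s_def using PT by (auto intro: LeastI Least_le)
  have decr: "\<beta> ^ t \<le> \<beta> ^ s" if "P t" for t
    using least[OF that] \<beta> by (intro power_decreasing) auto
  have \<alpha>: "\<alpha> = \<beta> ^ s"
    unfolding \<alpha>_def step_size_def \<delta>
  proof (rule Greatest_equality)
    show "\<beta> ^ s \<in> range (\<lambda>t. \<beta> ^ t) \<and>
        F (x + \<beta> ^ s *\<^sub>R d) \<le> F x + ereal (\<beta> ^ s * \<gamma>) * ereal \<delta>"
      using Ps unfolding P_def by blast
  next
    fix t
    assume "t \<in> range (\<lambda>t. \<beta> ^ t) \<and>
        F (x + t *\<^sub>R d) \<le> F x + ereal (t * \<gamma>) * ereal \<delta>"
    then show "t \<le> \<beta> ^ s"
      using decr unfolding P_def by blast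
  qed
  show "\<beta> ^ T \<le> \<alpha>"
    unfolding \<alpha> by (rule decr[OF PT])
  show "F (x + \<alpha> *\<^sub>R d) \<le> F x + ereal (\<alpha> * \<gamma>) * ereal \<delta>"
    using Ps unfolding \<alpha> P_def .
qed

text \<open>The line search succeeds for any positive definite matrix and accepts only points whose
  objective is at most a finite bound. Each step has its own coercivity constant here, because the
  matrices of earlier iterations obey no common bound.\<close>

lemma iterate_objective_finite:
  assumes par: "0 < \<beta>" "\<beta> < 1" "0 < \<gamma>" "\<gamma> < 1" "0 \<le> \<eta>" "\<eta> < 1"
    and "iterate blk f g \<psi> \<beta> \<gamma> \<eta> k x"
  shows "F x < \<infinity>"
  using assms(7)
proof (induction rule: iterate.induct)
  case (step k x i H d)
  obtain m where m: "0 < m" "\<And>h. h \<in> block_space blk i \<Longrightarrow> m * (h \<bullet> h) \<le> h \<bullet> (H *v h)"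
    using pos_def_on_block_imp_coercive[OF step.hyps(2)] by blast
  have d: "d \<in> block_space blk i"
    using step.hyps(3) by (simp add: approx_solution_def)
  obtain \<delta> q c where \<delta>: "model_decrease blk g \<psi> x i d = ereal \<delta>"
      "\<psi> i (block_part blk i x + d) = ereal c" "\<delta> \<le> - (m / 2) * (d \<bullet> d)"
    using approx_solution_decrease[OF step.IH m par(5,6) step.hyps(3)] by blast
  obtain Fx where Fx: "F x = ereal Fx"
    using objective_finite_imp_part_finite[OF step.IH] by blast
  have "0 < (1 - \<gamma>) * m / L i"
    using par m L_pos by simp
  then obtain T where "\<beta> ^ T < (1 - \<gamma>) * m / L i"
    using real_arch_pow_inv par by blast
  then have "F (x + step_size blk f g \<psi> \<beta> \<gamma> x i d *\<^sub>R d)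
      \<le> F x + ereal (step_size blk f g \<psi> \<beta> \<gamma> x i d * \<gamma>) * ereal \<delta>"
    using par by (intro step_size_bounds(2)[OF Fx d \<delta>(1,2) m(1) \<delta>(3), of \<beta> T]) auto
  also have "\<dots> < \<infinity>"
    by (simp add: Fx)
  finally show ?case .
qed

section \<open>The expected decrease\<close>

text \<open>The models are compared with trial steps that point towards the optimal set, along the
  block parts of \<open>s\<close>. The weights \<open>w\<^sub>i = \<alpha>\<^sub>i p\<^sub>i\<close> distort the sum over the blocks, so the step
  in block \<open>i\<close> is taken as \<open>(\<rho> / w\<^sub>i) s\<^sub>i\<close>; every block then contributes \<open>\<rho>\<close> times the slope of
  the objective in that block. The full gap \<open>D\<close> is gained per unit of \<open>\<rho>\<close> because strong
  convexity pays for the quadratic terms of the models.\<close>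

lemma weighted_subproblem_decrease:
  fixes w q :: "'b \<Rightarrow> real" and \<mu> \<pi> \<rho> D :: real
  assumes conv: "convex_on UNIV f" and x: "F x = ereal Fx" and \<mu>: "0 < \<mu>"
    and w: "\<And>i. 0 < w i" and \<pi>: "\<pi> = (MIN i. w i)"
    and \<rho>: "\<rho> = inverse (1 / \<pi> + (MAX i. spectral_norm (H i) / (\<mu> * w i)))"
    and q: "\<And>i e. e \<in> block_space blk i \<Longrightarrow> ereal (q i) \<le> subproblem blk g \<psi> x i (H i) e"
    and growth: "\<And>t. 0 \<le> t \<Longrightarrow> t \<le> 1 \<Longrightarrow>
      F (x + t *\<^sub>R s) \<le> ereal (Fx - t * D - 1/2 * \<mu> * t * (1 - t) * (s \<bullet> s))"
  shows "(\<Sum>i\<in>UNIV. w i * q i) \<le> - \<rho> * D"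
proof -
  define M where "M = (MAX i. spectral_norm (H i) / (\<mu> * w i))"
  have M: "spectral_norm (H i) / (\<mu> * w i) \<le> M" for i
    unfolding M_def by (intro Max_ge) auto
  have "0 \<le> M"
    using M[of undefined] spectral_norm_nonneg[of "H undefined"] \<mu> w[of undefined]
    by (meson divide_nonneg_pos mult_pos_pos order_trans)
  have \<pi>_le: "\<pi> \<le> w i" for i
    unfolding \<pi> by (intro Min_le) auto
  have "\<pi> \<in> range w"
    unfolding \<pi> by (intro Min_in) auto
  then have "0 < \<pi>"
    using w by auto
  have "0 < 1 / \<pi> + M"
    using \<open>0 < \<pi>\<close> \<open>0 \<le> M\<close> by (simp add: add_pos_nonneg)
  then have "0 < \<rho>" and "\<rho> * (1 / \<pi> + M) = 1"
    unfolding \<rho> M_def[symmetric] by auto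
  then have \<rho>_eq: "\<rho> / \<pi> + \<rho> * M = 1"
    by (simp add: distrib_left)
  (* Growth is used at x + theta * s. This theta balances the gain mu * (1 - theta) from
     strong convexity against the curvature cost mu * rho * M of the trial steps. *)
  define \<theta> where "\<theta> = \<rho> / \<pi>"
  have "0 < \<theta>" "\<theta> = 1 - \<rho> * M" "\<rho> = \<pi> * \<theta>" "0 \<le> \<rho> * M"
    using \<rho>_eq \<open>0 < \<rho>\<close> \<open>0 < \<pi>\<close> \<open>0 \<le> M\<close> by (simp_all add: \<theta>_def)
  then have \<theta>: "0 < \<theta>" "\<theta> \<le> 1" "\<rho> * M = 1 - \<theta>" "\<rho> = \<pi> * \<theta>"
    by linarith+
  let ?s = "\<lambda>i. block_part blk i s"
  let ?g = "\<lambda>i. block_part blk i (g x)"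
  have grow: "F (x + \<theta> *\<^sub>R s) \<le> ereal (Fx - \<theta> * D - 1/2 * \<mu> * \<theta> * (1 - \<theta>) * (s \<bullet> s))"
    using growth[of \<theta>] \<theta> by simp
  then have "F (x + \<theta> *\<^sub>R s) < \<infinity>"
    by (rule order_le_less_trans) simp
  then obtain c where c: "\<And>i. \<psi> i (block_part blk i (x + \<theta> *\<^sub>R s)) = ereal (c i)"
    and Fc: "F (x + \<theta> *\<^sub>R s) = ereal (f (x + \<theta> *\<^sub>R s) + (\<Sum>i\<in>UNIV. c i))"
    using objective_finite_imp_part_finite by metis
  have "F x < \<infinity>"
    by (simp add: x)
  then obtain a where a: "\<And>i. \<psi> i (block_part blk i x) = ereal (a i)"
    and Fa: "F x = ereal (f x + (\<Sum>i\<in>UNIV. a i))"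
    using objective_finite_imp_part_finite by metis
  (* The trial step in block i is the fraction r <= 1 of the step theta * s_i, chosen so that
     w i * r does not depend on i: the weighted linear terms then add up to one multiple of
     the linear term of f + psi for the full step theta * s. *)
  have block: "w i * q i \<le> \<pi> * (\<theta> * (?g i \<bullet> ?s i) + (c i - a i))
      + \<rho> * \<mu> * (1 - \<theta>) / 2 * (?s i \<bullet> ?s i)" for i
  proof -
    define r where "r = \<pi> / w i"
    have r: "0 \<le> r" "r \<le> 1" "w i * r = \<pi>"
      using \<pi>_le[of i] \<open>0 < \<pi>\<close> w[of i] by (auto simp: r_def)
    have ci: "\<psi> i (block_part blk i x + \<theta> *\<^sub>R ?s i) = ereal (c i)"
      using c[of i] by (simp add: block_part_add block_part_scale)
    obtain e where e: "\<psi> i (block_part blk i x + r *\<^sub>R \<theta> *\<^sub>R ?s i) = ereal e"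
      "e \<le> a i + r * (c i - a i)"
      using part_convex_along_segment[OF _ _ a ci r(1,2)] by (auto simp: scale_in_block_space)
    have "q i \<le> r * \<theta> * (?g i \<bullet> ?s i)
        + 1/2 * (r * \<theta>)\<^sup>2 * (?s i \<bullet> (H i *v ?s i)) + e - a i"
      using q[of "r *\<^sub>R \<theta> *\<^sub>R ?s i" i] e(1) a[of i]
      by (simp add: subproblem_def scale_in_block_space matrix_vector_mult_scaleR
          power2_eq_square mult_ac)
    with e(2) have "q i \<le> r * \<theta> * (?g i \<bullet> ?s i)
        + 1/2 * (r * \<theta>)\<^sup>2 * (?s i \<bullet> (H i *v ?s i)) + r * (c i - a i)"
      by linarith
    then have "w i * q i \<le> w i * (r * \<theta> * (?g i \<bullet> ?s i)
        + 1/2 * (r * \<theta>)\<^sup>2 * (?s i \<bullet> (H i *v ?s i)) + r * (c i - a i))"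
      using w[of i] by (intro mult_left_mono) auto
    also have "\<dots> = (w i * r) * (\<theta> * (?g i \<bullet> ?s i) + (c i - a i))
        + (w i * r) * \<theta> / 2 * ((r * \<theta>) * (?s i \<bullet> (H i *v ?s i)))"
      by (simp add: algebra_simps power2_eq_square)
    also have "\<dots> = \<pi> * (\<theta> * (?g i \<bullet> ?s i) + (c i - a i))
        + \<rho> / 2 * ((r * \<theta>) * (?s i \<bullet> (H i *v ?s i)))"
      by (simp add: r(3) \<theta>(4))
    also have "(r * \<theta>) * (?s i \<bullet> (H i *v ?s i)) \<le> (\<mu> * (1 - \<theta>)) * (?s i \<bullet> ?s i)"
    proof -
      have "r * \<theta> * spectral_norm (H i) = \<rho> * \<mu> * (spectral_norm (H i) / (\<mu> * w i))"
        using \<mu> w[of i] by (simp add: r_def \<theta>(4))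
      also have "\<dots> \<le> \<rho> * \<mu> * M"
        using M[of i] \<mu> \<open>0 < \<rho>\<close> by (intro mult_left_mono) auto
      also have "\<dots> = \<mu> * (1 - \<theta>)"
        by (simp add: \<theta>(3)[symmetric] mult_ac)
      finally have "r * \<theta> * spectral_norm (H i) * (?s i \<bullet> ?s i) \<le> (\<mu> * (1 - \<theta>)) * (?s i \<bullet> ?s i)"
        by (rule mult_right_mono) simp
      moreover have "(r * \<theta>) * (?s i \<bullet> (H i *v ?s i)) \<le> (r * \<theta>) * (spectral_norm (H i) * (?s i \<bullet> ?s i))"
        using r \<theta> by (intro mult_left_mono quadratic_form_le_spectral_norm) auto
      ultimately show ?thesis
        by (simp add: mult_ac)
    qed
    finally show ?thesis
      using \<open>0 < \<rho>\<close> by (simp add: mult_ac)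
  qed
  have "(\<Sum>i\<in>UNIV. w i * q i) \<le> (\<Sum>i\<in>UNIV. \<pi> * (\<theta> * (?g i \<bullet> ?s i) + (c i - a i))
      + \<rho> * \<mu> * (1 - \<theta>) / 2 * (?s i \<bullet> ?s i))"
    by (intro sum_mono block)
  also have "\<dots> = \<pi> * (\<theta> * (g x \<bullet> s) + ((\<Sum>i\<in>UNIV. c i) - (\<Sum>i\<in>UNIV. a i)))
      + \<rho> * \<mu> * (1 - \<theta>) / 2 * (s \<bullet> s)"
    by (simp only: sum.distrib sum_distrib_left[symmetric] sum_subtractf sum_inner_block_part)
  also have "\<dots> \<le> \<pi> * (- \<theta> * D - 1/2 * \<mu> * \<theta> * (1 - \<theta>) * (s \<bullet> s))
      + \<rho> * \<mu> * (1 - \<theta>) / 2 * (s \<bullet> s)"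
  proof -
    have "f x + \<theta> * (g x \<bullet> s) \<le> f (x + \<theta> *\<^sub>R s)"
      using convex_above_gradient[OF conv gradient, of x "\<theta> *\<^sub>R s"] by simp
    then have "\<theta> * (g x \<bullet> s) + ((\<Sum>i\<in>UNIV. c i) - (\<Sum>i\<in>UNIV. a i))
        \<le> - \<theta> * D - 1/2 * \<mu> * \<theta> * (1 - \<theta>) * (s \<bullet> s)"
      using grow Fc Fa x by simp
    then show ?thesis
      using \<open>0 < \<pi>\<close> by simp
  qed
  also have "\<dots> = - \<rho> * D"
    by (simp add: \<theta>(4) algebra_simps)
  finally show ?thesis .
qed

end

theorem theorem3:
  fixes blk :: "'n::finite \<Rightarrow> 'b::finite"
    and f :: "real^'n \<Rightarrow> real" and g :: "real^'n \<Rightarrow> real^'n"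
    and \<psi> :: "'b \<Rightarrow> real^'n \<Rightarrow> ereal" and F :: "real^'n \<Rightarrow> ereal"
    and L m :: "'b \<Rightarrow> real" and \<mu> \<beta> \<gamma> \<eta> :: real
  assumes "\<And>x. GDERIV f x :> g x" and "continuous_on UNIV g"
    and "convex_on UNIV f"
    and "\<And>i. 0 < L i" and "blockwise_lipschitz blk g L"
    and "\<And>i. ereal_convex_on (block_space blk i) (\<psi> i)"
    and "\<And>i. proper_on (block_space blk i) (\<psi> i)"
    and "\<And>i. closed_fun_on (block_space blk i) (\<psi> i)"
    and F_def: "F = objective blk f \<psi>"
    and "\<exists>b::real. \<forall>x. ereal b \<le> F x" and "minimizers F \<noteq> {}"
    and "0 < \<mu>" and "optimal_set_strongly_convex \<mu> F"
    and "0 < \<beta>" "\<beta> < 1" and "0 < \<gamma>" "\<gamma> < 1" and "0 \<le> \<eta>" "\<eta> < 1"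
    and "\<And>i. 0 < m i"
  shows "\<exists>c>0. \<forall>(k::nat) (x::real^'n) (H::'b \<Rightarrow> real^'n^'n) (d::'b \<Rightarrow> real^'n)
      (\<alpha>::'b \<Rightarrow> real) (p::'b pmf) (\<pi>::real).
    iterate blk f g \<psi> \<beta> \<gamma> \<eta> k x \<longrightarrow>
    (\<forall>i. sym_pos_def_on_block blk i (H i)) \<longrightarrow>
    (\<forall>i. \<forall>h\<in>block_space blk i. m i * (h \<bullet> h) \<le> h \<bullet> (H i *v h)) \<longrightarrow>
    (\<forall>i. approx_solution blk g \<psi> \<eta> x i (H i) (d i)) \<longrightarrow>
    (\<forall>i. \<alpha> i = step_size blk f g \<psi> \<beta> \<gamma> x i (d i)) \<longrightarrow>
    (\<forall>i. 0 < pmf p i) \<longrightarrow>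
    \<pi> = (MIN i. \<alpha> i * pmf p i) \<longrightarrow>
    (\<forall>i. c \<le> \<alpha> i) \<and>
    (min_value F < F x \<longrightarrow>
      (\<exists>\<rho>. inverse (1 / \<pi> + (MAX i. spectral_norm (H i) / (\<mu> * (\<alpha> i * pmf p i)))) \<le> \<rho> \<and>
        expected p (\<lambda>i. F (x + \<alpha> i *\<^sub>R d i) - min_value F) / (F x - min_value F)
          \<le> ereal (1 - (1 - \<eta>) * \<gamma> * \<rho>)))"
proof -
  obtain b where b: "\<And>x. ereal b \<le> F x"
    using assms(10) by blast
  interpret P: block_composite blk f g \<psi> L b
    using assms b by unfold_locales (auto simp: F_def)
  note \<mu> = \<open>0 < \<mu>\<close> and \<beta> = \<open>0 < \<beta>\<close> \<open>\<beta> < 1\<close> and \<gamma> = \<open>0 < \<gamma>\<close> \<open>\<gamma> < 1\<close>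
    and \<eta> = \<open>0 \<le> \<eta>\<close> \<open>\<eta> < 1\<close>
  have m: "0 < m i" for i
    using assms(20) .
  define \<epsilon> where "\<epsilon> = (MIN i. (1 - \<gamma>) * m i / L i)"
  have "\<epsilon> \<in> range (\<lambda>i. (1 - \<gamma>) * m i / L i)"
    unfolding \<epsilon>_def by (intro Min_in) auto
  then have "0 < \<epsilon>"
    using \<gamma> m P.L_pos by auto
  then obtain T where T: "\<beta> ^ T < \<epsilon>"
    using real_arch_pow_inv \<beta> by blast
  have T_le: "\<beta> ^ T \<le> (1 - \<gamma>) * m i / L i" for i
  proof -
    have "\<epsilon> \<le> (1 - \<gamma>) * m i / L i"
      unfolding \<epsilon>_def by (intro Min_le) auto
    with T show ?thesis by linarith
  qed
  have main: "(\<forall>i. \<beta> ^ T \<le> \<alpha> i) \<and>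
    (min_value F < F x \<longrightarrow>
      expected p (\<lambda>i. F (x + \<alpha> i *\<^sub>R d i) - min_value F) / (F x - min_value F)
        \<le> ereal (1 - (1 - \<eta>) * \<gamma> *
            inverse (1 / \<pi> + (MAX i. spectral_norm (H i) / (\<mu> * (\<alpha> i * pmf p i))))))"
    if iter: "iterate blk f g \<psi> \<beta> \<gamma> \<eta> k x"
      and coercive: "\<And>i h. h \<in> block_space blk i \<Longrightarrow> m i * (h \<bullet> h) \<le> h \<bullet> (H i *v h)"
      and approx: "\<And>i. approx_solution blk g \<psi> \<eta> x i (H i) (d i)"
      and \<alpha>: "\<And>i. \<alpha> i = step_size blk f g \<psi> \<beta> \<gamma> x i (d i)"
      and p: "\<And>i. 0 < pmf p i" and \<pi>: "\<pi> = (MIN i. \<alpha> i * pmf p i)"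
    for k x H d \<alpha> p \<pi>
  proof -
    have fin: "P.F x < \<infinity>"
      using P.iterate_objective_finite[OF \<beta> \<gamma> \<eta> iter] .
    then obtain Fx where Fx: "P.F x = ereal Fx"
      using P.objective_finite_imp_part_finite by metis
    have d: "d i \<in> block_space blk i" for i
      using approx[of i] by (simp add: approx_solution_def)
    have "\<exists>\<delta> q c. model_decrease blk g \<psi> x i (d i) = ereal \<delta> \<and>
        \<psi> i (block_part blk i x + d i) = ereal c \<and>
        (\<forall>e\<in>block_space blk i. ereal q \<le> subproblem blk g \<psi> x i (H i) e) \<and>
        \<delta> \<le> (1 - \<eta>) * q \<and> \<delta> \<le> - (m i / 2) * (d i \<bullet> d i)" for i
      using P.approx_solution_decrease[OF fin m coercive \<eta> approx] by metis
    then obtain \<delta> q c where \<delta>: "\<And>i. model_decrease blk g \<psi> x i (d i) = ereal (\<delta> i)"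
      and c: "\<And>i. \<psi> i (block_part blk i x + d i) = ereal (c i)"
      and q: "\<And>i e. e \<in> block_space blk i \<Longrightarrow> ereal (q i) \<le> subproblem blk g \<psi> x i (H i) e"
      and \<delta>q: "\<And>i. \<delta> i \<le> (1 - \<eta>) * q i"
      and \<delta>m: "\<And>i. \<delta> i \<le> - (m i / 2) * (d i \<bullet> d i)"
      by metis
    have \<alpha>_ge: "\<beta> ^ T \<le> \<alpha> i" and
      decrease: "P.F (x + \<alpha> i *\<^sub>R d i) \<le> P.F x + ereal (\<alpha> i * \<gamma>) * ereal (\<delta> i)" for i
      unfolding \<alpha> using P.step_size_bounds[OF Fx d \<delta> c m \<delta>m \<beta> T_le] by auto
    have \<alpha>_pos: "0 < \<alpha> i" for i
      using \<alpha>_ge[of i] \<beta> zero_less_power[of \<beta> T] by linarith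
    define \<rho> where "\<rho> = inverse (1 / \<pi> + (MAX i. spectral_norm (H i) / (\<mu> * (\<alpha> i * pmf p i))))"
    have "expected p (\<lambda>i. F (x + \<alpha> i *\<^sub>R d i) - min_value F) / (F x - min_value F)
        \<le> ereal (1 - (1 - \<eta>) * \<gamma> * \<rho>)" if gt: "min_value F < F x"
    proof -
      have "ereal b \<le> min_value F"
        unfolding min_value_def using b by (rule INF_greatest)
      then obtain Fs where Fs: "min_value F = ereal Fs" "Fs < Fx"
        using gt Fx F_def by (cases "min_value F") auto
      define s where "s = closest_point (minimizers F) x - x"
      have growth: "P.F (x + t *\<^sub>R s) \<le>
          ereal (Fx - t * (Fx - Fs) - 1/2 * \<mu> * t * (1 - t) * (s \<bullet> s))"
        if t: "0 \<le> t" "t \<le> 1" for t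
      proof -
        have "(1 - t) *\<^sub>R x + (1 - (1 - t)) *\<^sub>R closest_point (minimizers F) x = x + t *\<^sub>R s"
          by (simp add: s_def algebra_simps)
        moreover have "norm (x - closest_point (minimizers F) x) = norm s"
          by (simp add: s_def norm_minus_commute)
        ultimately have "F (x + t *\<^sub>R s) \<le> ereal (1 - t) * F x + ereal (1 - (1 - t)) * min_value F
            - ereal (1/2 * \<mu> * (1 - t) * (1 - (1 - t)) * (norm s)\<^sup>2)"
          using assms(13) t unfolding optimal_set_strongly_convex_def Let_def
          by (metis atLeastAtMost_iff diff_ge_0_iff_ge diff_le_eq le_add_same_cancel1)
        then show ?thesis
          using Fx Fs by (simp add: F_def dot_square_norm algebra_simps)
      qed
      have "(\<Sum>i\<in>UNIV. \<alpha> i * pmf p i * q i) \<le> - \<rho> * (Fx - Fs)"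
        using \<alpha>_pos p
        by (intro P.weighted_subproblem_decrease[OF assms(3) Fx \<mu> _ \<pi> \<rho>_def q growth]) auto
      then have "(1 - \<eta>) * \<gamma> * (\<Sum>i\<in>UNIV. \<alpha> i * pmf p i * q i)
          \<le> (1 - \<eta>) * \<gamma> * (- \<rho> * (Fx - Fs))"
        using \<eta> \<gamma> by (intro mult_left_mono) auto
      moreover have "(\<Sum>i\<in>UNIV. pmf p i * (\<alpha> i * \<gamma> * \<delta> i))
          \<le> (1 - \<eta>) * \<gamma> * (\<Sum>i\<in>UNIV. \<alpha> i * pmf p i * q i)"
      proof -
        have "pmf p i * (\<alpha> i * \<gamma> * \<delta> i) \<le> pmf p i * (\<alpha> i * \<gamma> * ((1 - \<eta>) * q i))" for i
          using \<delta>q[of i] \<alpha>_pos[of i] \<gamma> by (intro mult_left_mono) auto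
        then have "(\<Sum>i\<in>UNIV. pmf p i * (\<alpha> i * \<gamma> * \<delta> i))
            \<le> (\<Sum>i\<in>UNIV. pmf p i * (\<alpha> i * \<gamma> * ((1 - \<eta>) * q i)))"
          by (intro sum_mono)
        then show ?thesis
          by (simp add: sum_distrib_left mult_ac)
      qed
      ultimately have total: "(\<Sum>i\<in>UNIV. pmf p i * (\<alpha> i * \<gamma> * \<delta> i))
          \<le> - ((1 - \<eta>) * \<gamma> * \<rho>) * (Fx - Fs)"
        by (simp add: mult_ac)
      have "expected p (\<lambda>i. F (x + \<alpha> i *\<^sub>R d i) - min_value F)
          \<le> (\<Sum>i\<in>UNIV. ereal (pmf p i * (Fx + \<alpha> i * \<gamma> * \<delta> i - Fs)))"
        unfolding expected_def
      proof (rule sum_mono)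
        fix i
        have "F (x + \<alpha> i *\<^sub>R d i) - min_value F \<le> ereal (Fx + \<alpha> i * \<gamma> * \<delta> i) - ereal Fs"
          using decrease[of i] Fx Fs by (intro ereal_minus_mono) (auto simp: F_def)
        then have "ereal (pmf p i) * (F (x + \<alpha> i *\<^sub>R d i) - min_value F)
            \<le> ereal (pmf p i) * ereal (Fx + \<alpha> i * \<gamma> * \<delta> i - Fs)"
          by (intro ereal_mult_left_mono) auto
        then show "ereal (pmf p i) * (F (x + \<alpha> i *\<^sub>R d i) - min_value F)
            \<le> ereal (pmf p i * (Fx + \<alpha> i * \<gamma> * \<delta> i - Fs))"
          by simp
      qed
      also have "\<dots> = ereal ((\<Sum>i\<in>UNIV. pmf p i) * (Fx - Fs)
          + (\<Sum>i\<in>UNIV. pmf p i * (\<alpha> i * \<gamma> * \<delta> i)))"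
        by (simp add: sum_distrib_right sum.distrib[symmetric])
          (simp add: algebra_simps)
      also have "(\<Sum>i\<in>UNIV. pmf p i) = 1"
        by (rule sum_pmf_eq_1) auto
      also have "ereal (1 * (Fx - Fs) + (\<Sum>i\<in>UNIV. pmf p i * (\<alpha> i * \<gamma> * \<delta> i)))
          \<le> ereal ((1 - (1 - \<eta>) * \<gamma> * \<rho>) * (Fx - Fs))"
        using total by (simp add: algebra_simps)
      finally have E: "expected p (\<lambda>i. F (x + \<alpha> i *\<^sub>R d i) - min_value F)
          \<le> ereal ((1 - (1 - \<eta>) * \<gamma> * \<rho>) * (Fx - Fs))" .
      have gap: "F x - min_value F = ereal (Fx - Fs)"
        using Fx Fs F_def by simp
      have "expected p (\<lambda>i. F (x + \<alpha> i *\<^sub>R d i) - min_value F) / ereal (Fx - Fs)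
          \<le> ereal ((1 - (1 - \<eta>) * \<gamma> * \<rho>) * (Fx - Fs)) / ereal (Fx - Fs)"
        using Fs by (intro ereal_divide_right_mono E) auto
      then show ?thesis
        unfolding gap using Fs by simp
    qed
    with \<alpha>_ge show ?thesis
      unfolding \<rho>_def by blast
  qed
  show ?thesis
  proof (rule exI[of _ "\<beta> ^ T"], intro conjI allI impI)
    show "0 < \<beta> ^ T"
      using \<beta> by simp
  next
    fix k x H d \<alpha> p \<pi> i
    assume "iterate blk f g \<psi> \<beta> \<gamma> \<eta> k x"
      and "\<forall>i. sym_pos_def_on_block blk i (H i)"
      and "\<forall>i. \<forall>h\<in>block_space blk i. m i * (h \<bullet> h) \<le> h \<bullet> (H i *v h)"
      and "\<forall>i. approx_solution blk g \<psi> \<eta> x i (H i) (d i)"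
      and "\<forall>i. \<alpha> i = step_size blk f g \<psi> \<beta> \<gamma> x i (d i)"
      and "\<forall>i. 0 < pmf p i" and "\<pi> = (MIN i. \<alpha> i * pmf p i)"
    then show "\<beta> ^ T \<le> \<alpha> i"
      using main by blast
  next
    fix k x H d \<alpha> p \<pi>
    assume "iterate blk f g \<psi> \<beta> \<gamma> \<eta> k x"
      and "\<forall>i. sym_pos_def_on_block blk i (H i)"
      and "\<forall>i. \<forall>h\<in>block_space blk i. m i * (h \<bullet> h) \<le> h \<bullet> (H i *v h)"
      and "\<forall>i. approx_solution blk g \<psi> \<eta> x i (H i) (d i)"
      and "\<forall>i. \<alpha> i = step_size blk f g \<psi> \<beta> \<gamma> x i (d i)"
      and "\<forall>i. 0 < pmf p i" and "\<pi> = (MIN i. \<alpha> i * pmf p i)"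
      and "min_value F < F x"
    then show "\<exists>\<rho>. inverse (1 / \<pi> + (MAX i. spectral_norm (H i) / (\<mu> * (\<alpha> i * pmf p i)))) \<le> \<rho> \<and>
        expected p (\<lambda>i. F (x + \<alpha> i *\<^sub>R d i) - min_value F) / (F x - min_value F)
          \<le> ereal (1 - (1 - \<eta>) * \<gamma> * \<rho>)"
      using main by blast
  qed
qed

end
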